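(* Let $G$ be a (connected) path simply connected Cartan graph. Then the edge-colored graph $RB(G)$ is a rainbow boomerang graph.
   Context: Rainbow boomerang graphs. An edge-colored graph is a graph with a map from its edges onto a set of colors; it is properly colored if for each vertex the incident edges have pairwise distinct colors. A walk is a finite alternating sequence $v_0e_1v_1\dots e_kv_k$ ($k\ge0$ its length) with $e_i$ having ends $v_{i-1},v_i$; it is shortest if there is no shorter walk between the same pair of vertices, and rainbow if its edge colors are pairwise distinct. A rainbow boomerang graph is a properly colored edge-colored graph in which a walk is shortest if and only if it is rainbow. Semi Cartan graphs. A semi Cartan graph $G$ is an edge-colored graph (loops and multiple edges allowed) with vertex set $V$ and non-empty finite color set $I$, together with a generalized Cartan matrix $A^x=(a^x_{ij})_{i,j\in I}$ for each $x\in V$, such that: (CG1) each vertex is incident to exactly one edge of each color $i\in I$ (possibly a loop); (CG2) if $x,y$ are joined by an edge of color $i$, then the $i$-th rows of $A^x$ and $A^y$ agree. All semi Cartan graphs are assumed connected. Write $r_ix$ for the vertex joined to $x$ by the edge of color $i$ ($r_ix=x$ for a loop); $r_i$ is an involution. For each $x$ let $(\mathbb Z^I)^x$ be a copy of $\mathbb Z^I$ with standard basis $\{\alpha_i^x\}_{i\in I}$, and let $s_i^x:(\mathbb Z^I)^x\to(\mathbb Z^I)^{r_ix}$ be the linear map $\alpha_j^x\mapsto\alpha_j^{r_ix}-a_{ij}^x\alpha_i^{r_ix}$. The semi Weyl groupoid $W(G)$ has object set $V$, and $\operatorname{Hom}_{W(G)}(x,y)$ is the set of linear maps $(\mathbb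 Z^I)^x\to(\mathbb Z^I)^y$ of the form $s_{i_t}\cdots s_{i_1}\operatorname{id}_x$ with $t\ge0$ and $r_{i_t}\cdots r_{i_1}x=y$. Real roots: $R^x=\{w\alpha_i^y\mid y\in V,\ w\in\operatorname{Hom}_{W(G)}(y,x),\ i\in I\}$ and $R^{x+}=R^x\cap\sum_{i}\mathbb Z_{\ge0}\alpha_i^x$. A semi Cartan graph is a Cartan graph if (CG3) $R^x=R^{x+}\cup(-R^{x+})$ for all $x$; (CG4) if $w\in\operatorname{Hom}_{W(G)}(y,x)$ and $w\alpha_i^y\in R^{x+}$ for all $i\in I$, then $w=\operatorname{id}_x$ (in particular $x=y$). Path subgroupoid. $P(G)$ is the subgroupoid of $W(G)$ with the same objects generated by the morphisms $s_{i_t}\cdots s_{i_1}\operatorname{id}_x$ ($x\in V$) such that $r_{i_{s+1}}r_{i_s}\cdots r_{i_1}x\ne r_{i_s}\cdots r_{i_1}x$ for $0\le s\le t-1$ (i.e. no loop is used). $G$ is path simply connected if $\#\operatorname{Hom}_{P(G)}(x,y)=1$ for all $x,y\in V$. For $\alpha\in R^x$ let $\operatorname{orb}(\alpha)=\{w\alpha\mid y\in V,\ w\in\operatorname{Hom}_{P(G)}(x,y)\}\subseteq\bigsqcup_{y\in V}R^y$, and let $\Delta=\{\operatorname{orb}(\alpha)\mid\alpha\in R^x\}$, which is independent of $x$. If $G$ is path simply connected, each $O\in\Delta$ meets each $R^x$ in exactly one element, denoted $O_x$; put $\Delta^{x+}=\{O\in\Delta\mid O_x\in R^{x+}\}$ and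 $\Delta^{\mathrm{pure}+}=\bigcap_{x\in V}\Delta^{x+}$. The graph $RB(G)$, for $G$ a path simply connected Cartan graph: its underlying graph is that of $G$ with the loops removed; its color set is $C=\Delta^{x+}\setminus\Delta^{\mathrm{pure}+}$ for a fixed $x\in V$; each edge of $G$ of color $i$ between distinct vertices $z$ and $y$ is recolored by the unique $O\in C$ with $O_z\in\{\pm\alpha_i^z\}$. *)

theory Defs
  imports "HOL-Analysis.Finite_Cartesian_Product"
begin

section \<open>Edge-colored graphs and rainbow boomerang graphs\<close>

text \<open>
  Undirected multigraphs with loops: edges are abstract objects, \<open>ends e\<close> is the
  set of end vertices of \<open>e\<close>, which is a singleton precisely when \<open>e\<close> is a loop.
\<close>

record ('v, 'e, 'c) ecgraph =
  verts :: "'v set"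
  edges :: "'e set"
  ends :: "'e \<Rightarrow> 'v set"
  color :: "'e \<Rightarrow> 'c"
  colors :: "'c set"

definition edge_colored_graph :: "('v, 'e, 'c, 'm) ecgraph_scheme \<Rightarrow> bool" where
  "edge_colored_graph H \<longleftrightarrow>
     (\<forall>e\<in>edges H. \<exists>u\<in>verts H. \<exists>v\<in>verts H. ends H e = {u, v}) \<and>
     color H ` edges H = colors H"

definition properly_colored :: "('v, 'e, 'c, 'm) ecgraph_scheme \<Rightarrow> bool" where
  "properly_colored H \<longleftrightarrow>
     (\<forall>v\<in>verts H. inj_on (color H) {e \<in> edges H. v \<in> ends H e})"

text \<open>
  The walk \<open>v\<^sub>0 e\<^sub>1 v\<^sub>1 \<dots> e\<^sub>k v\<^sub>k\<close> is represented by the pair of lists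
  \<open>[v\<^sub>0, \<dots>, v\<^sub>k]\<close> and \<open>[e\<^sub>1, \<dots>, e\<^sub>k]\<close>; its length is the length of the second list.
\<close>

definition walk :: "('v, 'e, 'c, 'm) ecgraph_scheme \<Rightarrow> 'v list \<Rightarrow> 'e list \<Rightarrow> bool" where
  "walk H vs es \<longleftrightarrow>
     length vs = length es + 1 \<and> set vs \<subseteq> verts H \<and> set es \<subseteq> edges H \<and>
     (\<forall>k<length es. ends H (es ! k) = {vs ! k, vs ! (k + 1)})"

definition shortest_walk :: "('v, 'e, 'c, 'm) ecgraph_scheme \<Rightarrow> 'v list \<Rightarrow> 'e list \<Rightarrow> bool" where
  "shortest_walk H vs es \<longleftrightarrow>
     walk H vs es \<and>
     \<not> (\<exists>vs' es'. walk H vs' es' \<and> hd vs' = hd vs \<and> last vs' = last vs \<and>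
                  length es' < length es)"

definition rainbow_walk :: "('v, 'e, 'c, 'm) ecgraph_scheme \<Rightarrow> 'v list \<Rightarrow> 'e list \<Rightarrow> bool" where
  "rainbow_walk H vs es \<longleftrightarrow> walk H vs es \<and> distinct (map (color H) es)"

definition rainbow_boomerang_graph :: "('v, 'e, 'c, 'm) ecgraph_scheme \<Rightarrow> bool" where
  "rainbow_boomerang_graph H \<longleftrightarrow>
     edge_colored_graph H \<and> properly_colored H \<and>
     (\<forall>vs es. walk H vs es \<longrightarrow> (shortest_walk H vs es \<longleftrightarrow> rainbow_walk H vs es))"

definition connected_graph :: "('v, 'e, 'c, 'm) ecgraph_scheme \<Rightarrow> bool" where
  "connected_graph H \<longleftrightarrow>
     verts H \<noteq> {} \<and>
     (\<forall>x\<in>verts H. \<forall>y\<in>verts H. \<exists>vs es. walk H vs es \<and> hd vs = x \<and> last vs = y)"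


section \<open>Semi Cartan graphs\<close>

text \<open>
  The non-empty finite color set \<open>I\<close> of a semi Cartan graph is a finite type \<open>'i\<close>, and
  \<open>int ^ 'i\<close> serves as each of the copies of \<open>\<int>\<^sup>I\<close>. The vertex a copy
  belongs to is always carried along explicitly.
\<close>

record ('v, 'e, 'i::finite) cartan_data = "('v, 'e, 'i) ecgraph" +
  cartan :: "'v \<Rightarrow> int ^ 'i ^ 'i"

definition generalized_cartan_matrix :: "int ^ 'i::finite ^ 'i \<Rightarrow> bool" where
  "generalized_cartan_matrix A \<longleftrightarrow>
     (\<forall>i. A $ i $ i = 2) \<and>
     (\<forall>i j. i \<noteq> j \<longrightarrow> A $ i $ j \<le> 0) \<and>
     (\<forall>i j. A $ i $ j = 0 \<longrightarrow> A $ j $ i = 0)"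

definition semi_cartan_graph :: "('v, 'e, 'i::finite, 'm) cartan_data_scheme \<Rightarrow> bool" where
  "semi_cartan_graph G \<longleftrightarrow>
     edge_colored_graph G \<and> colors G = UNIV \<and> connected_graph G \<and>
     (\<forall>x\<in>verts G. generalized_cartan_matrix (cartan G x)) \<and>
     (\<forall>x\<in>verts G. \<forall>i. \<exists>!e. e \<in> edges G \<and> x \<in> ends G e \<and> color G e = i) \<and>
     (\<forall>x\<in>verts G. \<forall>y\<in>verts G. \<forall>e\<in>edges G. ends G e = {x, y} \<longrightarrow>
        cartan G x $ color G e = cartan G y $ color G e)"

definition refl_vert :: "('v, 'e, 'i::finite, 'm) cartan_data_scheme \<Rightarrow> 'i \<Rightarrow> 'v \<Rightarrow> 'v" where
  "refl_vert G i x = (THE y. \<exists>e\<in>edges G. color G e = i \<and> ends G e = {x, y})"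

abbreviation simple_root :: "'i::finite \<Rightarrow> int ^ 'i" where
  "simple_root i \<equiv> axis i 1"

text \<open>
  The linear extension of \<open>\<alpha>\<^sub>j \<mapsto> \<alpha>\<^sub>j - a\<^sub>i\<^sub>j \<alpha>\<^sub>i\<close>, as a map from the copy at
  \<open>x\<close> to the copy at \<open>refl_vert G i x\<close>.
\<close>

definition simple_refl ::
    "('v, 'e, 'i::finite, 'm) cartan_data_scheme \<Rightarrow> 'i \<Rightarrow> 'v \<Rightarrow> int ^ 'i \<Rightarrow> int ^ 'i" where
  "simple_refl G i x v =
     (\<Sum>j\<in>UNIV. v $ j *s (simple_root j - cartan G x $ i $ j *s simple_root i))"

text \<open>A word \<open>[i\<^sub>1, \<dots>, i\<^sub>t]\<close> is read in the order of application, \<open>i\<^sub>1\<close> first.\<close>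

primrec word_end :: "('v, 'e, 'i::finite, 'm) cartan_data_scheme \<Rightarrow> 'v \<Rightarrow> 'i list \<Rightarrow> 'v" where
  "word_end G x [] = x"
| "word_end G x (i # w) = word_end G (refl_vert G i x) w"

primrec word_map ::
    "('v, 'e, 'i::finite, 'm) cartan_data_scheme \<Rightarrow> 'v \<Rightarrow> 'i list \<Rightarrow> int ^ 'i \<Rightarrow> int ^ 'i" where
  "word_map G x [] = id"
| "word_map G x (i # w) = word_map G (refl_vert G i x) w \<circ> simple_refl G i x"

definition Hom_W ::
    "('v, 'e, 'i::finite, 'm) cartan_data_scheme \<Rightarrow> 'v \<Rightarrow> 'v \<Rightarrow> (int ^ 'i \<Rightarrow> int ^ 'i) set" where
  "Hom_W G x y = {word_map G x w | w. word_end G x w = y}"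

definition real_roots ::
    "('v, 'e, 'i::finite, 'm) cartan_data_scheme \<Rightarrow> 'v \<Rightarrow> (int ^ 'i) set" where
  "real_roots G x = {w (simple_root i) | y w i. y \<in> verts G \<and> w \<in> Hom_W G y x}"

definition pos_roots ::
    "('v, 'e, 'i::finite, 'm) cartan_data_scheme \<Rightarrow> 'v \<Rightarrow> (int ^ 'i) set" where
  "pos_roots G x = real_roots G x \<inter> {v. \<forall>i. 0 \<le> v $ i}"

definition cartan_graph :: "('v, 'e, 'i::finite, 'm) cartan_data_scheme \<Rightarrow> bool" where
  "cartan_graph G \<longleftrightarrow>
     semi_cartan_graph G \<and>
     (\<forall>x\<in>verts G. real_roots G x = pos_roots G x \<union> uminus ` pos_roots G x) \<and>
     (\<forall>x\<in>verts G. \<forall>y\<in>verts G. \<forall>w\<in>Hom_W G y x.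
        (\<forall>i. w (simple_root i) \<in> pos_roots G x) \<longrightarrow> x = y \<and> w = id)"


section \<open>The path subgroupoid\<close>

primrec loop_free :: "('v, 'e, 'i::finite, 'm) cartan_data_scheme \<Rightarrow> 'v \<Rightarrow> 'i list \<Rightarrow> bool" where
  "loop_free G x [] \<longleftrightarrow> True"
| "loop_free G x (i # w) \<longleftrightarrow> refl_vert G i x \<noteq> x \<and> loop_free G (refl_vert G i x) w"

text \<open>
  \<open>path_mor G x y f\<close> says that \<open>f\<close> is a morphism from \<open>x\<close> to \<open>y\<close> in the subgroupoid of
  \<open>W(G)\<close> generated by the loop-free words.
\<close>

inductive path_mor ::
    "('v, 'e, 'i::finite, 'm) cartan_data_scheme \<Rightarrow> 'v \<Rightarrow> 'v \<Rightarrow> (int ^ 'i \<Rightarrow> int ^ 'i) \<Rightarrow> bool"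
  for G where
  gen: "x \<in> verts G \<Longrightarrow> loop_free G x w \<Longrightarrow> path_mor G x (word_end G x w) (word_map G x w)"
| ident: "x \<in> verts G \<Longrightarrow> path_mor G x x id"
| comp: "path_mor G x y f \<Longrightarrow> path_mor G y z g \<Longrightarrow> path_mor G x z (g \<circ> f)"
| inverse: "path_mor G x y f \<Longrightarrow> g \<in> Hom_W G y x \<Longrightarrow> g \<circ> f = id \<Longrightarrow> f \<circ> g = id \<Longrightarrow>
    path_mor G y x g"

definition Hom_P ::
    "('v, 'e, 'i::finite, 'm) cartan_data_scheme \<Rightarrow> 'v \<Rightarrow> 'v \<Rightarrow> (int ^ 'i \<Rightarrow> int ^ 'i) set" where
  "Hom_P G x y = {f. path_mor G x y f}"

definition path_simply_connected :: "('v, 'e, 'i::finite, 'm) cartan_data_scheme \<Rightarrow> bool" where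
  "path_simply_connected G \<longleftrightarrow> (\<forall>x\<in>verts G. \<forall>y\<in>verts G. card (Hom_P G x y) = 1)"

text \<open>
  Subsets of the disjoint union of the sets \<open>real_roots G y\<close> are sets of pairs
  \<open>(y, \<beta>)\<close>.
\<close>

definition orb ::
    "('v, 'e, 'i::finite, 'm) cartan_data_scheme \<Rightarrow> 'v \<Rightarrow> int ^ 'i \<Rightarrow> ('v \<times> (int ^ 'i)) set" where
  "orb G x \<alpha> = {(y, w \<alpha>) | y w. y \<in> verts G \<and> w \<in> Hom_P G x y}"

text \<open>
  For a connected \<open>G\<close> the orbits of the roots at a single vertex already exhaust \<open>orbits G\<close>.
\<close>

definition orbits ::
    "('v, 'e, 'i::finite, 'm) cartan_data_scheme \<Rightarrow> ('v \<times> (int ^ 'i)) set set" where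
  "orbits G = {orb G x \<alpha> | x \<alpha>. x \<in> verts G \<and> \<alpha> \<in> real_roots G x}"

definition orb_at :: "('v \<times> (int ^ 'i::finite)) set \<Rightarrow> 'v \<Rightarrow> int ^ 'i" where
  "orb_at Q x = (THE \<beta>. (x, \<beta>) \<in> Q)"

definition pos_orbits ::
    "('v, 'e, 'i::finite, 'm) cartan_data_scheme \<Rightarrow> 'v \<Rightarrow> ('v \<times> (int ^ 'i)) set set" where
  "pos_orbits G x = {Q \<in> orbits G. orb_at Q x \<in> pos_roots G x}"

definition pure_pos_orbits ::
    "('v, 'e, 'i::finite, 'm) cartan_data_scheme \<Rightarrow> ('v \<times> (int ^ 'i)) set set" where
  "pure_pos_orbits G = (\<Inter>x\<in>verts G. pos_orbits G x)"


section \<open>The graph RB(G)\<close>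

definition RB_colors ::
    "('v, 'e, 'i::finite, 'm) cartan_data_scheme \<Rightarrow> 'v \<Rightarrow> ('v \<times> (int ^ 'i)) set set" where
  "RB_colors G x = pos_orbits G x - pure_pos_orbits G"

text \<open>
  The new color of an edge of color \<open>i\<close> between \<open>z\<close> and \<open>y\<close> is symmetric in \<open>z\<close>
  and \<open>y\<close>, since the simple reflection takes \<open>\<alpha>\<^sub>i\<close> at \<open>z\<close> to \<open>-\<alpha>\<^sub>i\<close> at \<open>y\<close>; the
  definition therefore refers to both ends.
\<close>

definition RB ::
    "('v, 'e, 'i::finite, 'm) cartan_data_scheme \<Rightarrow> 'v \<Rightarrow>
     ('v, 'e, ('v \<times> (int ^ 'i)) set) ecgraph" where
  "RB G x =
     \<lparr> verts = verts G,
       edges = {e \<in> edges G. \<not> (\<exists>z. ends G e = {z})},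
       ends = ends G,
       color = (\<lambda>e. THE Q. Q \<in> RB_colors G x \<and>
                  (\<forall>z\<in>ends G e. orb_at Q z \<in> {simple_root (color G e), - simple_root (color G e)})),
       colors = RB_colors G x \<rparr>"

end

theory Submission
  imports Defs
begin

text \<open>
  Path simple connectivity identifies the lattices at all vertices by transport along loop-free
  paths, so an orbit \<open>Q\<close> is one root seen from every vertex and has a sign at each of them.
  Crossing an edge of color \<open>i\<close> at \<open>z\<close> changes the signs of the two orbits passing through
  \<open>\<plusminus>\<alpha>\<^sub>i\<close> at \<open>z\<close> and of no others, and exactly one of these two is a color
  of the new graph, namely the color of that edge (\<open>positive_at_RB_step\<close>).  Hence each color \<open>Q\<close>
  behaves like a hyperplane: a walk crosses it an odd number of times if and only if \<open>Q\<close> has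
  opposite signs at the two ends of the walk, that is, \<open>Q\<close> separates the ends
  (\<open>positive_at_walk\<close>).

  A walk therefore uses every color separating its ends, and a rainbow walk uses each of them
  once and nothing else, so a rainbow walk is shortest.  For the converse it suffices that any
  two vertices \<open>u\<close>, \<open>v\<close> are joined by a walk whose length is the number of separating colors:
  then a shortest walk has no room for a repeated color.  Such a walk is built
  greedily, by leaving \<open>u\<close> through an edge whose color separates \<open>u\<close> from \<open>v\<close>.

  Axiom (CG4) provides a simple root at \<open>u \<noteq> v\<close> that is negative at \<open>v\<close>; the crux is that
  its index cannot be the color of a loop at \<open>u\<close>.  If it were, its orbit would change sign somewhere
  on the way from \<open>u\<close> to \<open>v\<close>, and so would be \<open>\<plusminus>\<alpha>\<^sub>j\<close> at a vertex \<open>z\<close>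
  moved by \<open>j\<close>; \<open>loop_root_not_transported_to_edge_root\<close> excludes this, since both the loop
  and the edge would then realize the reflection in the same root, and (CG4) would force their end
  vertices to coincide.
\<close>

section \<open>Reflections and words in a semi Cartan graph\<close>

lemma simple_refl_eq:
  "simple_refl G i x v = v - (\<Sum>j\<in>UNIV. v $ j * cartan G x $ i $ j) *s simple_root i"
proof -
  have "simple_refl G i x v $ k
      = (v - (\<Sum>j\<in>UNIV. v $ j * cartan G x $ i $ j) *s simple_root i) $ k" for k
  proof -
    have "simple_refl G i x v $ k
        = (\<Sum>j\<in>UNIV. v $ j * ((if k = j then 1 else 0) - cartan G x $ i $ j * (if k = i then 1 else 0)))"
      by (simp add: simple_refl_def axis_def eq_commute)
    also have "\<dots> = (\<Sum>j\<in>UNIV. (if k = j then v $ j else 0))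
        - (\<Sum>j\<in>UNIV. v $ j * cartan G x $ i $ j) * (if k = i then 1 else 0)"
      unfolding sum_distrib_right sum_subtractf[symmetric]
      by (rule sum.cong) (auto simp: algebra_simps)
    finally show ?thesis by (simp add: axis_def)
  qed
  then show ?thesis by (simp add: vec_eq_iff)
qed

lemma simple_refl_component: "k \<noteq> i \<Longrightarrow> simple_refl G i x v $ k = v $ k"
  by (simp add: simple_refl_eq axis_def)

lemma simple_refl_diff: "simple_refl G i x (u - v) = simple_refl G i x u - simple_refl G i x v"
  by (simp add: simple_refl_eq vec_eq_iff left_diff_distrib sum_subtractf)

lemma simple_refl_scale: "simple_refl G i x (c *s v) = c *s simple_refl G i x v"
  by (simp add: simple_refl_eq vec_eq_iff right_diff_distrib sum_distrib_left mult.assoc)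

lemma simple_root_index_unique:
  assumes "\<beta> = simple_root i \<or> \<beta> = - simple_root i" "\<beta> = simple_root j \<or> \<beta> = - simple_root j"
  shows "i = j"
proof (rule ccontr)
  assume "i \<noteq> j"
  then have "\<beta> $ i = 0" using assms(2) by (auto simp: axis_def)
  then show False using assms(1) by (auto simp: axis_def)
qed

lemma word_map_diff: "word_map G x w (u - v) = word_map G x w u - word_map G x w v"
  by (induction w arbitrary: x u v) (simp_all add: simple_refl_diff)

lemma word_map_scale: "word_map G x w (c *s v) = c *s word_map G x w v"
  by (induction w arbitrary: x v) (simp_all add: simple_refl_scale)

lemma word_map_uminus: "word_map G x w (- v) = - word_map G x w v"
  using word_map_diff[of G x w 0 v] word_map_diff[of G x w 0 0] by simp

lemma word_end_append: "word_end G x (v @ w) = word_end G (word_end G x v) w"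
  by (induction v arbitrary: x) simp_all

lemma word_map_append: "word_map G x (v @ w) = word_map G (word_end G x v) w \<circ> word_map G x v"
  by (induction v arbitrary: x) (simp_all add: comp_assoc)

lemma walk_Nil: "walk H vs [] \<longleftrightarrow> (\<exists>v\<in>verts H. vs = [v])"
  by (cases vs) (auto simp: walk_def)

lemma walk_Cons:
  "walk H vs (e # es) \<longleftrightarrow>
    (\<exists>v vs'. vs = v # vs' \<and> v \<in> verts H \<and> e \<in> edges H \<and> ends H e = {v, hd vs'} \<and> walk H vs' es)"
proof (cases vs)
  case Nil
  then show ?thesis by (simp add: walk_def)
next
  case (Cons v vs')
  have all: "(\<forall>k<Suc n. P k) \<longleftrightarrow> P 0 \<and> (\<forall>k<n. P (Suc k))" for n and P :: "nat \<Rightarrow> bool"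
    using less_Suc_eq_0_disj by auto
  show ?thesis
  proof (cases vs')
    case Nil
    then show ?thesis using Cons by (simp add: walk_def)
  next
    case (Cons a list)
    then show ?thesis using \<open>vs = v # vs'\<close> by (auto simp: walk_def all)
  qed
qed

lemma distinct_count_list: "distinct xs \<Longrightarrow> a \<in> set xs \<Longrightarrow> count_list xs a = 1"
  by (induction xs) (auto simp: count_list_0_iff)

locale semi_cartan =
  fixes G :: "('v, 'e, 'i::finite) cartan_data"
  assumes semi: "semi_cartan_graph G"
begin

lemma ends_in_verts:
  assumes "e \<in> edges G"
  shows "\<exists>u\<in>verts G. \<exists>v\<in>verts G. ends G e = {u, v}"
  using semi assms unfolding semi_cartan_graph_def edge_colored_graph_def by blast

lemma edge_unique:
  assumes "z \<in> verts G" "e \<in> edges G" "e' \<in> edges G" "z \<in> ends G e" "z \<in> ends G e'"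
    "color G e = color G e'"
  shows "e = e'"
proof -
  have "\<exists>!d. d \<in> edges G \<and> z \<in> ends G d \<and> color G d = color G e"
    using semi assms(1) unfolding semi_cartan_graph_def by blast
  then show ?thesis using assms by metis
qed

lemma refl_vert_eqI:
  assumes "z \<in> verts G" "e \<in> edges G" "ends G e = {z, y}"
  shows "refl_vert G (color G e) z = y"
  unfolding refl_vert_def
proof (rule the_equality)
  show "\<exists>d\<in>edges G. color G d = color G e \<and> ends G d = {z, y}" using assms by auto
next
  fix y' assume "\<exists>d\<in>edges G. color G d = color G e \<and> ends G d = {z, y'}"
  then obtain d where d: "d \<in> edges G" "color G d = color G e" "ends G d = {z, y'}" by auto
  then have "d = e" using edge_unique[of z d e] assms by simp
  then show "y' = y" using d assms(3) by (auto simp: doubleton_eq_iff)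
qed

lemma refl_edge:
  assumes "z \<in> verts G"
  obtains e where "e \<in> edges G" "color G e = i" "ends G e = {z, refl_vert G i z}"
proof -
  have "\<exists>!e. e \<in> edges G \<and> z \<in> ends G e \<and> color G e = i"
    using semi assms unfolding semi_cartan_graph_def by blast
  then obtain e where e: "e \<in> edges G" "z \<in> ends G e" "color G e = i" by blast
  obtain u v where "ends G e = {u, v}" using ends_in_verts e(1) by blast
  then obtain y where y: "ends G e = {z, y}" using e(2) by (cases "z = u") auto
  then have "refl_vert G i z = y" using refl_vert_eqI assms e by auto
  then show ?thesis using that e y by simp
qed

lemma refl_vert_in [simp]:
  assumes "z \<in> verts G"
  shows "refl_vert G i z \<in> verts G"
proof -
  obtain e where e: "e \<in> edges G" "color G e = i" "ends G e = {z, refl_vert G i z}"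
    using refl_edge[OF assms] .
  then show ?thesis using ends_in_verts[of e] by (auto simp: doubleton_eq_iff)
qed

lemma refl_vert_invol [simp]:
  assumes "z \<in> verts G"
  shows "refl_vert G i (refl_vert G i z) = z"
proof -
  obtain e where e: "e \<in> edges G" "color G e = i" "ends G e = {z, refl_vert G i z}"
    using refl_edge[OF assms] .
  then have "ends G e = {refl_vert G i z, z}" by auto
  then show ?thesis using refl_vert_eqI[of "refl_vert G i z" e z] e assms by simp
qed

lemma cartan_diag [simp]: "z \<in> verts G \<Longrightarrow> cartan G z $ i $ i = 2"
  using semi unfolding semi_cartan_graph_def generalized_cartan_matrix_def by blast

lemma cartan_refl_vert:
  assumes "z \<in> verts G"
  shows "cartan G (refl_vert G i z) $ i = cartan G z $ i"
proof -
  obtain e where e: "e \<in> edges G" "color G e = i" "ends G e = {z, refl_vert G i z}"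
    using refl_edge[OF assms] .
  have "cartan G z $ color G e = cartan G (refl_vert G i z) $ color G e"
    using semi e assms refl_vert_in[OF assms] unfolding semi_cartan_graph_def by blast
  then show ?thesis using e(2) by simp
qed

lemma simple_refl_root: "z \<in> verts G \<Longrightarrow> simple_refl G i z (simple_root i) = - simple_root i"
  by (simp add: simple_refl_eq vec_eq_iff axis_def if_distrib[of "\<lambda>t. t * _"] cong: if_cong)

lemma simple_refl_invol:
  assumes "z \<in> verts G"
  shows "simple_refl G i (refl_vert G i z) (simple_refl G i z v) = v"
proof -
  have "simple_refl G i (refl_vert G i z) u = simple_refl G i z u" for u
    by (simp add: simple_refl_eq cartan_refl_vert assms)
  moreover have "simple_refl G i z (simple_refl G i z v) = v"
  proof -
    let ?s = "\<Sum>j\<in>UNIV. v $ j * cartan G z $ i $ j"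
    have "simple_refl G i z (simple_refl G i z v)
        = simple_refl G i z v - ?s *s simple_refl G i z (simple_root i)"
      by (subst (2) simple_refl_eq) (simp add: simple_refl_diff simple_refl_scale)
    also have "\<dots> = v"
      unfolding simple_refl_root[OF assms] by (simp add: simple_refl_eq vec_eq_iff)
    finally show ?thesis .
  qed
  ultimately show ?thesis by simp
qed

lemma word_end_in [simp]: "z \<in> verts G \<Longrightarrow> word_end G z w \<in> verts G"
  by (induction w arbitrary: z) simp_all

lemma word_end_rev: "z \<in> verts G \<Longrightarrow> word_end G (word_end G z w) (rev w) = z"
  by (induction w arbitrary: z) (simp_all add: word_end_append)

lemma word_map_rev:
  "z \<in> verts G \<Longrightarrow> word_map G (word_end G z w) (rev w) (word_map G z w v) = v"
  by (induction w arbitrary: z v)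
    (simp_all add: word_map_append word_end_rev simple_refl_invol)

lemma real_rootE:
  assumes "\<beta> \<in> real_roots G z"
  obtains y w i where "y \<in> verts G" "word_end G y w = z" "\<beta> = word_map G y w (simple_root i)"
  using assms unfolding real_roots_def Hom_W_def by blast

lemma real_root_word_map:
  assumes "\<beta> \<in> real_roots G z"
  shows "word_map G z w \<beta> \<in> real_roots G (word_end G z w)"
proof -
  obtain y v i where *: "y \<in> verts G" "word_end G y v = z" "\<beta> = word_map G y v (simple_root i)"
    using assms by (rule real_rootE)
  have "word_map G z w \<beta> = word_map G y (v @ w) (simple_root i)"
    "word_end G y (v @ w) = word_end G z w"
    using * by (simp_all add: word_map_append word_end_append)
  then show ?thesis using *(1) unfolding real_roots_def Hom_W_def by blast
qed

lemma simple_root_real: "z \<in> verts G \<Longrightarrow> simple_root i \<in> real_roots G z"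
  unfolding real_roots_def Hom_W_def by (force intro: exI[of _ "[]"])

lemma simple_refl_real:
  "\<beta> \<in> real_roots G z \<Longrightarrow> simple_refl G i z \<beta> \<in> real_roots G (refl_vert G i z)"
  using real_root_word_map[of \<beta> z "[i]"] by simp

text \<open>
  Real roots are images of basis vectors under automorphisms of the lattice, hence primitive
  vectors.  In particular \<open>\<plusminus>\<alpha>\<^sub>i\<close> are the only roots proportional to \<open>\<alpha>\<^sub>i\<close>.
\<close>

lemma real_root_primitive:
  assumes "c *s \<gamma> \<in> real_roots G z"
  shows "c = 1 \<or> c = - 1"
proof -
  obtain y w i where *: "y \<in> verts G" "word_end G y w = z" "c *s \<gamma> = word_map G y w (simple_root i)"
    using assms by (rule real_rootE)
  have "simple_root i = word_map G z (rev w) (c *s \<gamma>)"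
    using word_map_rev[OF *(1), of w "simple_root i"] * by simp
  then have "simple_root i $ i = c * word_map G z (rev w) \<gamma> $ i"
    by (simp add: word_map_scale)
  then have "c * word_map G z (rev w) \<gamma> $ i = 1" by (simp add: axis_def)
  then show ?thesis using zmult_eq_1_iff by blast
qed

text \<open>Dropping the loops from a walk leaves a loop-free word with the same ends.\<close>

lemma loop_free_word_of_walk:
  "walk G vs es \<Longrightarrow> \<exists>w. loop_free G (hd vs) w \<and> word_end G (hd vs) w = last vs"
proof (induction es arbitrary: vs)
  case Nil
  then show ?case by (auto simp: walk_Nil intro: exI[of _ "[]"])
next
  case (Cons e es)
  then obtain v vs' where vs: "vs = v # vs'" "v \<in> verts G" "e \<in> edges G" "ends G e = {v, hd vs'}"
    "walk G vs' es" by (auto simp: walk_Cons)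
  then obtain w where w: "loop_free G (hd vs') w" "word_end G (hd vs') w = last vs'"
    using Cons.IH by blast
  have "vs' \<noteq> []" using vs(5) by (auto simp: walk_def)
  have r: "refl_vert G (color G e) v = hd vs'" using vs by (intro refl_vert_eqI)
  show ?case
  proof (cases "hd vs' = v")
    case True
    then show ?thesis using w vs(1) \<open>vs' \<noteq> []\<close> by auto
  next
    case False
    then show ?thesis using w vs(1) \<open>vs' \<noteq> []\<close> r by (intro exI[of _ "color G e # w"]) auto
  qed
qed

lemma loop_free_word_exists:
  assumes "u \<in> verts G" "v \<in> verts G"
  obtains w where "loop_free G u w" "word_end G u w = v"
proof -
  obtain vs es where "walk G vs es" "hd vs = u" "last vs = v"
    using semi assms unfolding semi_cartan_graph_def connected_graph_def by blast
  then show ?thesis using loop_free_word_of_walk that by blast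
qed

end

section \<open>Signs of roots in a Cartan graph\<close>

locale simply_connected_cartan = semi_cartan G
  for G :: "('v, 'e, 'i::finite) cartan_data" +
  assumes cartan: "cartan_graph G"
    and simply_connected: "path_simply_connected G"
begin

lemma real_roots_eq:
  assumes "z \<in> verts G"
  shows "real_roots G z = pos_roots G z \<union> uminus ` pos_roots G z"
  using cartan assms unfolding cartan_graph_def by blast

lemma real_root_cases:
  assumes "z \<in> verts G" "\<beta> \<in> real_roots G z"
  shows "\<beta> \<in> pos_roots G z \<or> - \<beta> \<in> pos_roots G z"
  using assms(2) unfolding real_roots_eq[OF assms(1)] by auto

lemma real_root_uminus:
  assumes "z \<in> verts G" "\<beta> \<in> real_roots G z"
  shows "- \<beta> \<in> real_roots G z"
  using assms(2) unfolding real_roots_eq[OF assms(1)] by auto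

lemma pos_rootD: "\<beta> \<in> pos_roots G z \<Longrightarrow> 0 \<le> \<beta> $ k"
  by (simp add: pos_roots_def)

lemma real_root_nonzero: "\<beta> \<in> real_roots G z \<Longrightarrow> \<beta> \<noteq> 0"
  using real_root_primitive[of 0 \<beta> z] by auto

lemma pos_root_uminus_iff:
  assumes "z \<in> verts G" "\<beta> \<in> real_roots G z"
  shows "- \<beta> \<in> pos_roots G z \<longleftrightarrow> \<beta> \<notin> pos_roots G z"
proof -
  have "\<not> (\<beta> \<in> pos_roots G z \<and> - \<beta> \<in> pos_roots G z)"
  proof
    assume "\<beta> \<in> pos_roots G z \<and> - \<beta> \<in> pos_roots G z"
    then have "0 \<le> \<beta> $ k" "0 \<le> (- \<beta>) $ k" for k using pos_rootD by blast+
    then have "\<beta> = 0" by (simp add: vec_eq_iff order_antisym)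
    then show False using real_root_nonzero assms by blast
  qed
  then show ?thesis using real_root_cases[OF assms] by blast
qed

lemma pos_root_iff_coeff:
  assumes "z \<in> verts G" "\<beta> \<in> real_roots G z" "\<beta> $ k \<noteq> 0"
  shows "\<beta> \<in> pos_roots G z \<longleftrightarrow> 0 < \<beta> $ k"
  using real_root_cases[OF assms(1,2)] pos_root_uminus_iff[OF assms(1,2)] assms(3)
    pos_rootD[of \<beta> z k] pos_rootD[of "- \<beta>" z k] by auto

lemma simple_root_pos: "z \<in> verts G \<Longrightarrow> simple_root i \<in> pos_roots G z"
  using simple_root_real[of z i] by (simp add: pos_roots_def axis_def)

lemma real_root_multiple_of_simple:
  assumes "\<beta> \<in> real_roots G z" "\<And>k. k \<noteq> i \<Longrightarrow> \<beta> $ k = 0"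
  shows "\<beta> = simple_root i \<or> \<beta> = - simple_root i"
proof -
  have eq: "\<beta> = \<beta> $ i *s simple_root i" using assms(2) by (simp add: vec_eq_iff axis_def)
  then have "\<beta> $ i = 1 \<or> \<beta> $ i = - 1" using real_root_primitive assms(1) by metis
  then show ?thesis
  proof
    assume "\<beta> $ i = 1"
    then show ?thesis using assms(2) by (simp add: vec_eq_iff axis_def)
  next
    assume "\<beta> $ i = - 1"
    then show ?thesis using assms(2) by (simp add: vec_eq_iff axis_def)
  qed
qed

text \<open>
  The reflection at \<open>\<alpha>\<^sub>i\<close> changes the \<open>i\<close>-th coordinate alone.  A root with another nonzero
  coordinate keeps that coordinate, and by sign-coherence keeps its sign; the remaining roots are
  multiples of \<open>\<alpha>\<^sub>i\<close>.
\<close>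

lemma simple_refl_sign:
  assumes z: "z \<in> verts G" and \<beta>: "\<beta> \<in> real_roots G z"
  shows "(simple_refl G i z \<beta> \<in> pos_roots G (refl_vert G i z) \<longleftrightarrow> \<beta> \<in> pos_roots G z)
    \<longleftrightarrow> \<beta> \<noteq> simple_root i \<and> \<beta> \<noteq> - simple_root i"
proof (cases "\<exists>k. k \<noteq> i \<and> \<beta> $ k \<noteq> 0")
  case True
  then obtain k where k: "k \<noteq> i" "\<beta> $ k \<noteq> 0" by blast
  have "\<beta> \<noteq> simple_root i \<and> \<beta> \<noteq> - simple_root i" using k by (auto simp: axis_def)
  moreover have "simple_refl G i z \<beta> \<in> pos_roots G (refl_vert G i z) \<longleftrightarrow> \<beta> \<in> pos_roots G z"
    using pos_root_iff_coeff[of z \<beta> k] k z \<beta> simple_refl_real[OF \<beta>, of i]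
      pos_root_iff_coeff[of "refl_vert G i z" "simple_refl G i z \<beta>" k]
    by (simp add: simple_refl_component)
  ultimately show ?thesis by blast
next
  case False
  then have *: "\<beta> = simple_root i \<or> \<beta> = - simple_root i"
    using real_root_multiple_of_simple[OF \<beta>] by blast
  have r: "refl_vert G i z \<in> verts G" using z by simp
  have m: "simple_refl G i z (- simple_root i) = simple_root i"
    using word_map_uminus[of G z "[i]" "simple_root i"] simple_refl_root[OF z, of i] by simp
  show ?thesis
    using * simple_root_pos[OF z, of i] simple_root_pos[OF r, of i]
      pos_root_uminus_iff[OF z simple_root_real[OF z], of i]
      pos_root_uminus_iff[OF r simple_root_real[OF r], of i] simple_refl_root[OF z, of i] m
    by auto
qed

text \<open>The part of (CG4) about objects, phrased for words.\<close>

lemma all_simple_roots_pos_imp_eq: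
  assumes "y \<in> verts G" "\<And>k. word_map G y w (simple_root k) \<in> pos_roots G (word_end G y w)"
  shows "word_end G y w = y"
proof -
  have "word_map G y w \<in> Hom_W G y (word_end G y w)" unfolding Hom_W_def by blast
  then show ?thesis using cartan assms word_end_in unfolding cartan_graph_def by blast
qed


section \<open>Transport along loop-free paths\<close>

definition transport :: "'v \<Rightarrow> 'v \<Rightarrow> int ^ 'i \<Rightarrow> int ^ 'i" where
  "transport u v = (THE f. f \<in> Hom_P G u v)"

lemma Hom_P_eq:
  assumes "u \<in> verts G" "v \<in> verts G"
  shows "Hom_P G u v = {transport u v}"
proof -
  have "card (Hom_P G u v) = 1"
    using simply_connected assms unfolding path_simply_connected_def by blast
  then obtain f where "Hom_P G u v = {f}" by (rule card_1_singletonE)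
  then show ?thesis by (simp add: transport_def)
qed

lemma transport_path_mor: "u \<in> verts G \<Longrightarrow> v \<in> verts G \<Longrightarrow> path_mor G u v (transport u v)"
  using Hom_P_eq unfolding Hom_P_def by blast

lemma transport_eqI:
  assumes "u \<in> verts G" "v \<in> verts G" "path_mor G u v f"
  shows "transport u v = f"
proof -
  have "f \<in> Hom_P G u v" using assms(3) by (simp add: Hom_P_def)
  then show ?thesis using Hom_P_eq[OF assms(1,2)] by simp
qed

lemma transport_word:
  assumes "u \<in> verts G" "v \<in> verts G"
  obtains w where "word_end G u w = v" "transport u v = word_map G u w"
  using loop_free_word_exists[OF assms] path_mor.gen[OF assms(1)] transport_eqI[OF assms] by metis

lemma transport_self: "u \<in> verts G \<Longrightarrow> transport u u \<beta> = \<beta>"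
  using transport_eqI[of u u id] path_mor.ident[of u G] by simp

lemma transport_trans:
  "u \<in> verts G \<Longrightarrow> v \<in> verts G \<Longrightarrow> w \<in> verts G \<Longrightarrow> transport v w (transport u v \<beta>) = transport u w \<beta>"
  using transport_eqI[of u w "transport v w \<circ> transport u v"]
    path_mor.comp[OF transport_path_mor[of u v] transport_path_mor[of v w]] by simp

lemma transport_step:
  assumes "u \<in> verts G" "refl_vert G i u \<noteq> u"
  shows "transport u (refl_vert G i u) = simple_refl G i u"
  using transport_eqI[of u "refl_vert G i u"] path_mor.gen[of u G "[i]"] assms by simp

lemma transport_real:
  "u \<in> verts G \<Longrightarrow> v \<in> verts G \<Longrightarrow> \<beta> \<in> real_roots G u \<Longrightarrow> transport u v \<beta> \<in> real_roots G v"
  using transport_word[of u v] real_root_word_map by metis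

lemma transport_uminus:
  "u \<in> verts G \<Longrightarrow> v \<in> verts G \<Longrightarrow> transport u v (- \<beta>) = - transport u v \<beta>"
  using transport_word[of u v] word_map_uminus by metis

text \<open>
  If \<open>\<alpha>\<^sub>i\<close> at a loop of \<open>u\<close> becomes \<open>\<plusminus>\<alpha>\<^sub>j\<close> at \<open>z\<close>, conjugating the
  loop reflection by transport gives an automorphism at \<open>z\<close> that negates \<open>\<alpha>\<^sub>j\<close> and is the
  identity modulo \<open>\<alpha>\<^sub>j\<close>.  Followed by the reflection along the edge \<open>j\<close>, it fixes
  \<open>\<alpha>\<^sub>j\<close> and keeps the coefficient \<open>1\<close> of \<open>\<alpha>\<^sub>k\<close> in the image of every other
  \<open>\<alpha>\<^sub>k\<close>, so all images of simple roots are positive and (CG4) yields \<open>r\<^sub>j z = z\<close>.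
\<close>

lemma loop_root_not_transported_to_edge_root:
  assumes u: "u \<in> verts G" and z: "z \<in> verts G"
    and loop: "refl_vert G i u = u" and edge: "refl_vert G j z \<noteq> z"
    and eq: "transport u z (simple_root i) = \<epsilon> *s simple_root j" and \<epsilon>: "\<epsilon> = 1 \<or> \<epsilon> = - 1"
  shows False
proof -
  obtain v where v: "word_end G z v = u" "transport z u = word_map G z v"
    using transport_word z u by blast
  obtain w where w: "word_end G u w = z" "transport u z = word_map G u w"
    using transport_word z u by blast
  \<comment> \<open>Go from \<open>z\<close> to \<open>u\<close>, run through the loop, return to \<open>z\<close>, cross the edge \<open>j\<close>.\<close>
  let ?word = "v @ i # w @ [j]"
  have end_eq: "word_end G z ?word = refl_vert G j z"
    using v w loop by (simp add: word_end_append)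
  have map_eq: "word_map G z ?word \<beta>
      = simple_refl G j z (transport u z (simple_refl G i u (transport z u \<beta>)))" for \<beta>
    using v w loop by (simp add: word_map_append word_end_append)
  have inv: "transport u z (transport z u \<beta>) = \<beta>" for \<beta>
    using transport_trans transport_self u z by simp
  have step: "word_map G z ?word (simple_root k) \<in> pos_roots G (refl_vert G j z)" for k
  proof (cases "k = j")
    case True
    have neg: "c *s (- \<gamma>) = - (c *s \<gamma>)" for c and \<gamma> :: "int ^ 'i"
      by (simp add: vec_eq_iff)
    have "transport z u (\<epsilon> *s simple_root j) = simple_root i"
      using eq[symmetric] transport_trans[OF u z u] transport_self[OF u] by simp
    then have "\<epsilon> *s transport z u (simple_root j) = simple_root i"
      by (simp add: v(2) word_map_scale)
    then have "\<epsilon> *s (\<epsilon> *s transport z u (simple_root j)) = \<epsilon> *s simple_root i" by simp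
    then have "transport z u (simple_root j) = \<epsilon> *s simple_root i"
      using \<epsilon> by (elim disjE) (simp_all add: vec_eq_iff)
    then have "transport u z (simple_refl G i u (transport z u (simple_root j)))
        = - (\<epsilon> *s (\<epsilon> *s simple_root j))"
      using eq simple_refl_root[OF u, of i] w(2)
      by (simp add: simple_refl_scale word_map_scale word_map_uminus neg)
    also have "\<dots> = - simple_root j" using \<epsilon> by (auto simp: vec_eq_iff)
    finally have "word_map G z ?word (simple_root j) = simple_refl G j z (- simple_root j)"
      by (simp only: map_eq)
    also have "\<dots> = simple_root j"
      using word_map_uminus[of G z "[j]" "simple_root j"] simple_refl_root[OF z, of j] by simp
    finally show ?thesis using True simple_root_pos z by simp
  next
    case False
    define c where "c = (\<Sum>l\<in>UNIV. transport z u (simple_root k) $ l * cartan G u $ i $ l)"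
    have "transport u z (simple_refl G i u (transport z u (simple_root k)))
        = simple_root k - c *s (\<epsilon> *s simple_root j)"
      using inv[of "simple_root k"] eq w(2)
      by (simp add: simple_refl_eq[of G i u] c_def word_map_diff word_map_scale)
    then have "word_map G z ?word (simple_root k) $ k = 1"
      unfolding map_eq using False by (simp add: simple_refl_component axis_def)
    moreover have "word_map G z ?word (simple_root k) \<in> real_roots G (refl_vert G j z)"
      using real_root_word_map[OF simple_root_real[OF z], of ?word k] end_eq by simp
    ultimately show ?thesis using pos_root_iff_coeff[of "refl_vert G j z" _ k] z by simp
  qed
  have "word_end G z ?word = z"
    by (rule all_simple_roots_pos_imp_eq[OF z]) (simp only: end_eq step)
  then show False using end_eq edge by simp
qed


section \<open>Orbits and their signs\<close>

lemma orb_eq: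
  assumes "z \<in> verts G"
  shows "orb G z \<alpha> = {(y, transport z y \<alpha>) | y. y \<in> verts G}"
  unfolding orb_def using Hom_P_eq[OF assms] by auto

lemma orb_at_orb: "z \<in> verts G \<Longrightarrow> y \<in> verts G \<Longrightarrow> orb_at (orb G z \<alpha>) y = transport z y \<alpha>"
  by (simp add: orb_at_def orb_eq)

lemma orbitE:
  assumes "Q \<in> orbits G" "z \<in> verts G"
  obtains "Q = orb G z (orb_at Q z)" "orb_at Q z \<in> real_roots G z"
proof -
  obtain x \<alpha> where Q: "Q = orb G x \<alpha>" "x \<in> verts G" "\<alpha> \<in> real_roots G x"
    using assms(1) unfolding orbits_def by blast
  have "orb G z (transport x z \<alpha>) = orb G x \<alpha>"
    using transport_trans[OF Q(2) assms(2)] by (auto simp: orb_eq assms(2) Q(2))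
  then show ?thesis using that Q assms(2) by (simp add: orb_at_orb transport_real)
qed

lemma orb_in_orbits: "z \<in> verts G \<Longrightarrow> \<alpha> \<in> real_roots G z \<Longrightarrow> orb G z \<alpha> \<in> orbits G"
  unfolding orbits_def by blast

lemma transport_orb_at:
  "Q \<in> orbits G \<Longrightarrow> z \<in> verts G \<Longrightarrow> y \<in> verts G \<Longrightarrow> transport z y (orb_at Q z) = orb_at Q y"
  using orbitE[of Q z] orb_at_orb[of z y "orb_at Q z"] by metis

definition positive_at :: "('v \<times> (int ^ 'i)) set \<Rightarrow> 'v \<Rightarrow> bool" where
  "positive_at Q z \<longleftrightarrow> orb_at Q z \<in> pos_roots G z"

lemma positive_at_step:
  assumes "Q \<in> orbits G" "z \<in> verts G" "refl_vert G i z \<noteq> z"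
  shows "(positive_at Q (refl_vert G i z) \<longleftrightarrow> positive_at Q z)
    \<longleftrightarrow> orb_at Q z \<noteq> simple_root i \<and> orb_at Q z \<noteq> - simple_root i"
proof -
  have "orb_at Q (refl_vert G i z) = simple_refl G i z (orb_at Q z)"
    using transport_orb_at[OF assms(1,2), of "refl_vert G i z"] transport_step assms(2,3) by simp
  moreover have "orb_at Q z \<in> real_roots G z" using assms(1,2) by (rule orbitE)
  ultimately show ?thesis using simple_refl_sign[OF assms(2)] unfolding positive_at_def by simp
qed

lemma sign_change_along_word:
  assumes "Q \<in> orbits G"
  shows "z \<in> verts G \<Longrightarrow> loop_free G z w \<Longrightarrow> positive_at Q z \<noteq> positive_at Q (word_end G z w) \<Longrightarrow>
    \<exists>y\<in>verts G. \<exists>j. refl_vert G j y \<noteq> y \<and> (orb_at Q y = simple_root j \<or> orb_at Q y = - simple_root j)"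
proof (induction w arbitrary: z)
  case Nil
  then show ?case by simp
next
  case (Cons i w)
  show ?case
  proof (cases "positive_at Q (refl_vert G i z) = positive_at Q z")
    case True
    then show ?thesis using Cons.IH[of "refl_vert G i z"] Cons.prems by simp
  next
    case False
    then show ?thesis using positive_at_step[OF assms, of z i] Cons.prems by auto
  qed
qed

text \<open>
  The greedy step towards \<open>v\<close>: (CG4) gives a simple root at \<open>u\<close> turning negative at \<open>v\<close>,
  and a loop root cannot turn negative, because every sign change happens across an
  edge where the root is simple up to sign.
\<close>

lemma exists_separating_edge:
  assumes u: "u \<in> verts G" and v: "v \<in> verts G" and "u \<noteq> v"
  obtains i where "refl_vert G i u \<noteq> u" "transport u v (simple_root i) \<notin> pos_roots G v"
proof -
  obtain w where w: "loop_free G u w" "word_end G u w = v"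
    using loop_free_word_exists u v by blast
  have t: "transport u v = word_map G u w"
    using transport_eqI[OF u v] path_mor.gen[OF u w(1)] w(2) by simp
  obtain i where i: "transport u v (simple_root i) \<notin> pos_roots G v"
    using all_simple_roots_pos_imp_eq[OF u, of w] w(2) t assms(3) by auto
  have "refl_vert G i u \<noteq> u"
  proof
    assume loop: "refl_vert G i u = u"
    define Q where "Q = orb G u (simple_root i)"
    have Q: "Q \<in> orbits G" unfolding Q_def using orb_in_orbits simple_root_real u by blast
    have at: "orb_at Q y = transport u y (simple_root i)" if "y \<in> verts G" for y
      using orb_at_orb u that by (simp add: Q_def)
    have "positive_at Q u" "\<not> positive_at Q v"
      using at u v i simple_root_pos transport_self by (simp_all add: positive_at_def)
    then obtain y j where "y \<in> verts G" "refl_vert G j y \<noteq> y"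
      "orb_at Q y = 1 *s simple_root j \<or> orb_at Q y = (- 1) *s simple_root j"
      using sign_change_along_word[OF Q u w(1)] w(2) by (auto simp: vec_eq_iff)
    then show False
      using loop_root_not_transported_to_edge_root[OF u, of y i j] loop at by metis
  qed
  then show ?thesis using that i by blast
qed


section \<open>The rainbow boomerang graph of a Cartan graph\<close>

context
  fixes x
  assumes x: "x \<in> verts G"
begin

lemma RB_simps [simp]:
  "verts (RB G x) = verts G" "ends (RB G x) = ends G" "colors (RB G x) = RB_colors G x"
  by (simp_all add: RB_def)

lemma RB_colors_iff:
  "Q \<in> RB_colors G x \<longleftrightarrow> Q \<in> orbits G \<and> positive_at Q x \<and> (\<exists>y\<in>verts G. \<not> positive_at Q y)"
  using x by (auto simp: RB_colors_def pure_pos_orbits_def pos_orbits_def positive_at_def)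

text \<open>
  Every color is positive at the base vertex \<open>x\<close>, so the colors contain no two opposite orbits.
\<close>

lemma RB_colors_eqI:
  assumes "Q \<in> RB_colors G x" "Q' \<in> RB_colors G x" "z \<in> verts G"
    and "orb_at Q z = orb_at Q' z \<or> orb_at Q z = - orb_at Q' z"
  shows "Q = Q'"
proof -
  have Q: "Q \<in> orbits G" "positive_at Q x" and Q': "Q' \<in> orbits G" "positive_at Q' x"
    using assms(1,2) by (auto simp: RB_colors_iff)
  have "orb_at Q z \<noteq> - orb_at Q' z"
  proof
    assume *: "orb_at Q z = - orb_at Q' z"
    have "orb_at Q x = transport z x (- orb_at Q' z)"
      using transport_orb_at[OF Q(1) assms(3) x] * by simp
    also have "\<dots> = - orb_at Q' x"
      using transport_uminus transport_orb_at[OF Q'(1)] assms(3) x by simp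
    finally show False
      using Q(2) Q'(2) pos_root_uminus_iff[OF x, of "orb_at Q' x"] orbitE[OF Q'(1) x]
      by (auto simp: positive_at_def)
  qed
  then have "orb_at Q z = orb_at Q' z" using assms(4) by blast
  then show ?thesis using orbitE[OF Q(1) assms(3)] orbitE[OF Q'(1) assms(3)] by metis
qed

lemma RB_edgeD:
  assumes "e \<in> edges (RB G x)"
  shows "e \<in> edges G"
    and "z \<in> verts G \<Longrightarrow> ends G e = {z, y} \<Longrightarrow> y = refl_vert G (color G e) z \<and> y \<noteq> z"
  using assms refl_vert_eqI[of z e y] by (auto simp: RB_def)

lemma RB_edgeE:
  assumes "e \<in> edges (RB G x)"
  obtains z where "z \<in> verts G" "ends G e = {z, refl_vert G (color G e) z}"
    "refl_vert G (color G e) z \<noteq> z"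
  using ends_in_verts[OF RB_edgeD(1)[OF assms]] RB_edgeD(2)[OF assms] by metis

lemma refl_edge_RB:
  assumes "z \<in> verts G" "refl_vert G i z \<noteq> z"
  obtains e where "e \<in> edges (RB G x)" "color G e = i" "ends G e = {z, refl_vert G i z}"
proof -
  obtain e where e: "e \<in> edges G" "color G e = i" "ends G e = {z, refl_vert G i z}"
    using refl_edge[OF assms(1)] .
  moreover have "\<not> (\<exists>y. ends G e = {y})" using e(3) assms(2) by (auto simp: doubleton_eq_iff)
  ultimately show ?thesis using that by (simp add: RB_def)
qed

text \<open>
  Of the two opposite orbits through \<open>\<plusminus>\<alpha>\<^sub>i\<close> at an end of the edge, take the one that is
  positive at \<open>x\<close>.  It changes sign across the edge and so is not purely positive.
\<close>

lemma RB_color_exists: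
  assumes "e \<in> edges (RB G x)"
  shows "\<exists>Q \<in> RB_colors G x.
    \<forall>y\<in>ends G e. orb_at Q y \<in> {simple_root (color G e), - simple_root (color G e)}"
proof -
  define i where "i = color G e"
  obtain z where z: "z \<in> verts G" "ends G e = {z, refl_vert G i z}" "refl_vert G i z \<noteq> z"
    using RB_edgeE[OF assms] unfolding i_def .
  have real: "transport z x (simple_root i) \<in> real_roots G x"
    using transport_real z(1) x simple_root_real by blast
  obtain \<beta> where \<beta>: "\<beta> = simple_root i \<or> \<beta> = - simple_root i" "transport z x \<beta> \<in> pos_roots G x"
    using real_root_cases[OF x real] transport_uminus[OF z(1) x] by metis
  define Q where "Q = orb G z \<beta>"
  have at: "orb_at Q y = transport z y \<beta>" if "y \<in> verts G" for y
    using orb_at_orb z(1) that by (simp add: Q_def)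
  have Q: "Q \<in> orbits G"
    unfolding Q_def using \<beta>(1) orb_in_orbits z(1) simple_root_real real_root_uminus by blast
  have atz: "orb_at Q z = \<beta>" using at z(1) transport_self by simp
  have "orb_at Q (refl_vert G i z) = simple_refl G i z \<beta>"
    using at transport_step z by simp
  also have "\<dots> = - \<beta>"
    using \<beta>(1) simple_refl_root[OF z(1), of i] word_map_uminus[of G z "[i]" "simple_root i"] by auto
  finally have ends: "\<forall>y\<in>ends G e. orb_at Q y \<in> {simple_root i, - simple_root i}"
    using atz \<beta>(1) z(2) by auto
  have "positive_at Q (refl_vert G i z) \<noteq> positive_at Q z"
    using positive_at_step[OF Q z(1,3)] atz \<beta>(1) by auto
  then have "\<exists>y\<in>verts G. \<not> positive_at Q y" using z(1) refl_vert_in by blast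
  moreover have "positive_at Q x" using \<beta>(2) at x by (simp add: positive_at_def)
  ultimately have "Q \<in> RB_colors G x" using Q by (simp add: RB_colors_iff)
  then show ?thesis using ends unfolding i_def by (rule bexI[rotated])
qed

lemma RB_color:
  assumes "e \<in> edges (RB G x)"
  shows "color (RB G x) e \<in> RB_colors G x"
    and "y \<in> ends G e \<Longrightarrow> orb_at (color (RB G x) e) y = simple_root (color G e)
      \<or> orb_at (color (RB G x) e) y = - simple_root (color G e)"
proof -
  let ?P = "\<lambda>Q. Q \<in> RB_colors G x \<and>
    (\<forall>y\<in>ends G e. orb_at Q y \<in> {simple_root (color G e), - simple_root (color G e)})"
  obtain z where z: "z \<in> verts G" "z \<in> ends G e" using RB_edgeE[OF assms] by (metis insertI1)
  obtain Q where Q: "?P Q" using RB_color_exists[OF assms] by blast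
  have "Q' = Q" if "?P Q'" for Q'
    using that Q z by (intro RB_colors_eqI[of Q' Q z]) force+
  then have "?P (THE Q. ?P Q)" using Q by (intro theI[of ?P]) blast+
  moreover have "color (RB G x) e = (THE Q. ?P Q)" by (simp add: RB_def)
  ultimately have P: "?P (color (RB G x) e)" by simp
  then show "color (RB G x) e \<in> RB_colors G x" by blast
  show "y \<in> ends G e \<Longrightarrow> orb_at (color (RB G x) e) y = simple_root (color G e)
      \<or> orb_at (color (RB G x) e) y = - simple_root (color G e)" using P by blast
qed

lemma positive_at_RB_step:
  assumes e: "e \<in> edges (RB G x)" "ends G e = {z, y}" and z: "z \<in> verts G"
    and Q: "Q \<in> RB_colors G x"
  shows "positive_at Q y = positive_at Q z \<longleftrightarrow> color (RB G x) e \<noteq> Q"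
proof -
  have y: "y = refl_vert G (color G e) z" "y \<noteq> z" using RB_edgeD(2)[OF e(1) z e(2)] by auto
  have c: "orb_at (color (RB G x) e) z = simple_root (color G e)
      \<or> orb_at (color (RB G x) e) z = - simple_root (color G e)"
    using RB_color(2)[OF e(1), of z] e(2) by simp
  have "color (RB G x) e = Q \<longleftrightarrow>
      orb_at Q z = simple_root (color G e) \<or> orb_at Q z = - simple_root (color G e)"
    using c RB_colors_eqI[OF RB_color(1)[OF e(1)] Q z] by auto
  then show ?thesis
    using positive_at_step[of Q z "color G e"] Q y z by (auto simp: RB_colors_iff)
qed

lemma positive_at_walk:
  assumes "Q \<in> RB_colors G x" "walk (RB G x) vs es"
  shows "positive_at Q (hd vs) \<noteq> positive_at Q (last vs)
    \<longleftrightarrow> odd (count_list (map (color (RB G x)) es) Q)"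
  using assms(2)
proof (induction es arbitrary: vs)
  case Nil
  then show ?case by (auto simp: walk_Nil)
next
  case (Cons e es)
  then obtain v vs' where vs: "vs = v # vs'" "v \<in> verts G" "e \<in> edges (RB G x)"
    "ends G e = {v, hd vs'}" "walk (RB G x) vs' es" by (auto simp: walk_Cons)
  have "vs' \<noteq> []" using vs(5) by (auto simp: walk_def)
  then show ?case
    using Cons.IH[OF vs(5)] positive_at_RB_step[OF vs(3,4,2) assms(1)] vs(1) by auto
qed

definition separators :: "'v \<Rightarrow> 'v \<Rightarrow> ('v \<times> (int ^ 'i)) set set" where
  "separators u v = {Q \<in> RB_colors G x. positive_at Q u \<noteq> positive_at Q v}"

lemma separators_subset_colors:
  assumes "walk (RB G x) vs es"
  shows "separators (hd vs) (last vs) \<subseteq> color (RB G x) ` set es"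
proof
  fix Q assume "Q \<in> separators (hd vs) (last vs)"
  then have "odd (count_list (map (color (RB G x)) es) Q)"
    using positive_at_walk[OF _ assms] by (auto simp: separators_def)
  then have "count_list (map (color (RB G x)) es) Q \<noteq> 0" by (metis even_zero)
  then show "Q \<in> color (RB G x) ` set es" by (simp add: count_list_0_iff)
qed

lemma separators_rainbow:
  assumes "rainbow_walk (RB G x) vs es"
  shows "separators (hd vs) (last vs) = color (RB G x) ` set es"
proof
  have w: "walk (RB G x) vs es" and d: "distinct (map (color (RB G x)) es)"
    using assms by (auto simp: rainbow_walk_def)
  show "separators (hd vs) (last vs) \<subseteq> color (RB G x) ` set es"
    using separators_subset_colors[OF w] .
  show "color (RB G x) ` set es \<subseteq> separators (hd vs) (last vs)"
  proof
    fix Q assume Q: "Q \<in> color (RB G x) ` set es"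
    then have "count_list (map (color (RB G x)) es) Q = 1"
      using d by (simp add: distinct_count_list)
    moreover have "Q \<in> RB_colors G x" using Q w RB_color(1) by (auto simp: walk_def)
    ultimately show "Q \<in> separators (hd vs) (last vs)"
      using positive_at_walk[OF _ w] by (simp add: separators_def)
  qed
qed

lemma card_separators_le:
  assumes "walk (RB G x) vs es"
  shows "card (separators (hd vs) (last vs)) \<le> card (color (RB G x) ` set es)"
  by (intro card_mono separators_subset_colors[OF assms]) simp

lemma RB_connected:
  "u \<in> verts G \<Longrightarrow> loop_free G u w \<Longrightarrow>
    \<exists>vs es. walk (RB G x) vs es \<and> hd vs = u \<and> last vs = word_end G u w"
proof (induction w arbitrary: u)
  case Nil
  then show ?case by (intro exI[of _ "[u]"] exI[of _ "[]"]) (simp add: walk_Nil)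
next
  case (Cons i w)
  let ?u = "refl_vert G i u"
  obtain vs es where w: "walk (RB G x) vs es" "hd vs = ?u" "last vs = word_end G ?u w"
    using Cons.IH[of ?u] Cons.prems by auto
  obtain e where "e \<in> edges (RB G x)" "ends G e = {u, ?u}"
    using refl_edge_RB[of u i] Cons.prems by auto
  then have "walk (RB G x) (u # vs) (e # es)" using w Cons.prems by (auto simp: walk_Cons)
  moreover have "vs \<noteq> []" using w(1) by (auto simp: walk_def)
  ultimately show ?case using w(3) by (intro exI[of _ "u # vs"] exI[of _ "e # es"]) simp
qed

lemma RB_walk_exists:
  assumes "u \<in> verts G" "v \<in> verts G"
  obtains vs es where "walk (RB G x) vs es" "hd vs = u" "last vs = v"
  using loop_free_word_exists[OF assms] RB_connected[OF assms(1)] by metis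

lemma finite_separators:
  assumes "u \<in> verts G" "v \<in> verts G"
  shows "finite (separators u v)"
proof -
  obtain vs es where "walk (RB G x) vs es" "hd vs = u" "last vs = v"
    using RB_walk_exists[OF assms] .
  then show ?thesis using finite_subset[OF separators_subset_colors] by blast
qed

text \<open>
  Crossing an edge alters the sign of its own color alone; if that color separates \<open>u\<close> from
  \<open>v\<close>, crossing the edge removes exactly it from the separating colors.
\<close>

lemma separators_step:
  assumes "u \<in> verts G" "v \<in> verts G" "u \<noteq> v"
  obtains e u' where "e \<in> edges (RB G x)" "u' \<in> verts G" "ends G e = {u, u'}"
    "color (RB G x) e \<in> separators u v"
    "separators u' v = separators u v - {color (RB G x) e}"
proof -
  obtain i where i: "refl_vert G i u \<noteq> u" "transport u v (simple_root i) \<notin> pos_roots G v"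
    using exists_separating_edge[OF assms] .
  obtain e where e: "e \<in> edges (RB G x)" "color G e = i" "ends G e = {u, refl_vert G i u}"
    using refl_edge_RB[OF assms(1) i(1)] .
  let ?Q = "color (RB G x) e"
  have Q: "?Q \<in> RB_colors G x" using RB_color(1)[OF e(1)] .
  then have orbit: "?Q \<in> orbits G" by (simp add: RB_colors_iff)
  have atu: "orb_at ?Q u = simple_root i \<or> orb_at ?Q u = - simple_root i"
    using RB_color(2)[OF e(1), of u] e(2,3) by simp
  have atv: "orb_at ?Q v = transport u v (orb_at ?Q u)"
    using transport_orb_at[OF orbit assms(1,2)] by simp
  have "positive_at ?Q u \<noteq> positive_at ?Q v"
    using atu
  proof
    assume *: "orb_at ?Q u = simple_root i"
    then show ?thesis
      using atv i(2) simple_root_pos[OF assms(1)] by (simp add: positive_at_def)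
  next
    assume *: "orb_at ?Q u = - simple_root i"
    then have "orb_at ?Q v = - transport u v (simple_root i)"
      using atv transport_uminus[OF assms(1,2)] by simp
    then show ?thesis
      using * i(2) simple_root_pos[OF assms(1), of i]
        pos_root_uminus_iff[OF assms(1) simple_root_real[OF assms(1)], of i]
        pos_root_uminus_iff[OF assms(2) transport_real[OF assms(1,2) simple_root_real[OF assms(1)]], of i]
      by (simp add: positive_at_def)
  qed
  then have sep: "?Q \<in> separators u v" using Q by (simp add: separators_def)
  have "Q' \<in> separators (refl_vert G i u) v \<longleftrightarrow> Q' \<in> separators u v - {?Q}" for Q'
    using positive_at_RB_step[OF e(1,3) assms(1), of Q'] sep by (auto simp: separators_def)
  then have "separators (refl_vert G i u) v = separators u v - {?Q}" by blast
  then show ?thesis by (rule that[OF e(1) refl_vert_in[OF assms(1)] e(3) sep])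
qed

lemma walk_of_length_card_separators:
  assumes "v \<in> verts G"
  shows "u \<in> verts G \<Longrightarrow> card (separators u v) = n \<Longrightarrow>
    \<exists>vs es. walk (RB G x) vs es \<and> hd vs = u \<and> last vs = v \<and> length es = n"
proof (induction n arbitrary: u)
  case 0
  then have "separators u v = {}" using finite_separators[OF 0(1) assms] by simp
  then have "u = v" using separators_step[OF 0(1) assms] by (metis empty_iff)
  then show ?case using assms by (intro exI[of _ "[u]"] exI[of _ "[]"]) (simp add: walk_Nil)
next
  case (Suc n)
  have "u \<noteq> v" using Suc.prems(2) by (auto simp: separators_def)
  then obtain e u' where e: "e \<in> edges (RB G x)" "u' \<in> verts G" "ends G e = {u, u'}"
    "color (RB G x) e \<in> separators u v"
    "separators u' v = separators u v - {color (RB G x) e}"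
    using separators_step[OF Suc.prems(1) assms] by blast
  then have "card (separators u' v) = n" using Suc.prems(2) by simp
  then obtain vs es where w: "walk (RB G x) vs es" "hd vs = u'" "last vs = v" "length es = n"
    using Suc.IH e(2) by blast
  have "walk (RB G x) (u # vs) (e # es)" using w e Suc.prems by (auto simp: walk_Cons)
  moreover have "vs \<noteq> []" using w(1) by (auto simp: walk_def)
  ultimately show ?case using w by (intro exI[of _ "u # vs"] exI[of _ "e # es"]) simp
qed

text \<open>
  Both directions compare with the number of separating colors, which bounds the length of every
  walk from below and is attained both by rainbow walks and by some walk between the given ends.
\<close>

lemma shortest_iff_rainbow:
  assumes w: "walk (RB G x) vs es"
  shows "shortest_walk (RB G x) vs es \<longleftrightarrow> rainbow_walk (RB G x) vs es"
proof
  have "vs \<noteq> []" "set vs \<subseteq> verts G" using w by (auto simp: walk_def)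
  then have V: "hd vs \<in> verts G" "last vs \<in> verts G"
    using hd_in_set[of vs] last_in_set[of vs] by blast+
  assume "shortest_walk (RB G x) vs es"
  moreover obtain vs' es' where "walk (RB G x) vs' es'" "hd vs' = hd vs" "last vs' = last vs"
    "length es' = card (separators (hd vs) (last vs))"
    using walk_of_length_card_separators[OF V(2,1)] by blast
  ultimately have "length es \<le> card (separators (hd vs) (last vs))"
    unfolding shortest_walk_def by (metis not_le)
  also have "\<dots> \<le> card (color (RB G x) ` set es)" using card_separators_le[OF w] .
  finally have "card (set (map (color (RB G x)) es)) = length (map (color (RB G x)) es)"
    using card_length[of "map (color (RB G x)) es"] by simp
  then show "rainbow_walk (RB G x) vs es"
    using w card_distinct unfolding rainbow_walk_def by blast
next
  assume r: "rainbow_walk (RB G x) vs es"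
  have "length es \<le> length es'"
    if w': "walk (RB G x) vs' es'" "hd vs' = hd vs" "last vs' = last vs" for vs' es'
  proof -
    have "length es = card (separators (hd vs) (last vs))"
      using separators_rainbow[OF r] r distinct_card[of "map (color (RB G x)) es"]
      by (simp add: rainbow_walk_def)
    also have "\<dots> \<le> card (color (RB G x) ` set es')" using card_separators_le[OF w'(1)] w' by simp
    also have "\<dots> \<le> length es'" using card_length[of "map (color (RB G x)) es'"] by simp
    finally show ?thesis .
  qed
  then show "shortest_walk (RB G x) vs es"
    using w unfolding shortest_walk_def by (meson not_le)
qed

text \<open>
  Each color really occurs: it is positive at \<open>x\<close> and negative at some \<open>y\<close>, so every walk from
  \<open>x\<close> to \<open>y\<close> has to use it.
\<close>

lemma RB_edge_colored: "edge_colored_graph (RB G x)"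
  unfolding edge_colored_graph_def
proof
  show "\<forall>e\<in>edges (RB G x). \<exists>u\<in>verts (RB G x). \<exists>v\<in>verts (RB G x). ends (RB G x) e = {u, v}"
    using ends_in_verts RB_edgeD(1) by simp
  have "Q \<in> color (RB G x) ` edges (RB G x)" if Q: "Q \<in> RB_colors G x" for Q
  proof -
    obtain y where y: "y \<in> verts G" "positive_at Q x \<noteq> positive_at Q y"
      using Q by (auto simp: RB_colors_iff)
    obtain vs es where w: "walk (RB G x) vs es" "hd vs = x" "last vs = y"
      using RB_walk_exists[OF x y(1)] .
    have "Q \<in> color (RB G x) ` set es"
      using separators_subset_colors[OF w(1)] w y(2) Q by (auto simp: separators_def)
    then show ?thesis using w(1) by (auto simp: walk_def)
  qed
  then show "color (RB G x) ` edges (RB G x) = colors (RB G x)" using RB_color(1) by auto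
qed

lemma RB_properly_colored: "properly_colored (RB G x)"
  unfolding properly_colored_def
proof (intro ballI inj_onI)
  fix z d e
  assume z: "z \<in> verts (RB G x)"
    and "d \<in> {e \<in> edges (RB G x). z \<in> ends (RB G x) e}" "e \<in> {e \<in> edges (RB G x). z \<in> ends (RB G x) e}"
    and c: "color (RB G x) d = color (RB G x) e"
  then have d: "d \<in> edges (RB G x)" "z \<in> ends G d" and e: "e \<in> edges (RB G x)" "z \<in> ends G e" by auto
  have "color G d = color G e"
    using RB_color(2)[OF d] RB_color(2)[OF e] c simple_root_index_unique by metis
  then show "d = e" using edge_unique z d e RB_edgeD(1) by simp
qed

lemma RB_rainbow_boomerang: "rainbow_boomerang_graph (RB G x)"
  unfolding rainbow_boomerang_graph_def
  using RB_edge_colored RB_properly_colored shortest_iff_rainbow by blast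

end

end

theorem theorem3p25:
  fixes G :: "('v, 'e, 'i::finite) cartan_data" and x :: 'v
  assumes "cartan_graph G"
    and "path_simply_connected G"
    and "x \<in> verts G"
  shows "rainbow_boomerang_graph (RB G x)"
proof -
  interpret simply_connected_cartan G
    using assms(1,2) by unfold_locales (simp_all add: cartan_graph_def)
  show ?thesis using RB_rainbow_boomerang[OF assms(3)] .
qed

end
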